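(* Let $n$ be a positive integer, let $K\ge 1$, $K'\ge 0$ be constants, and let $f:B^n\to\mathbb{C}^n$ be a (holomorphic) $(K,K')$-quasiregular mapping of the unit ball $B^n$ into $\mathbb{C}^n$ with $\lambda_f(0)\ge\alpha>0$. Then $$\beta_f\ge\frac{\alpha^2}{4(2K\alpha+K'+\alpha)}.$$
   Context: $B^n=\{z\in\mathbb{C}^n:|z|<1\}$ is the open unit ball for the Euclidean norm. For a holomorphic mapping $f$ into $\mathbb{C}^n$, $f'(z)=(\partial f_i/\partial z_k)_{i,k}$ is the complex Jacobian matrix. With $A=f'(z)$ and $A^*$ its conjugate transpose, $\lambda_f(z)\ge0$ and $\Lambda_f(z)\ge0$ are defined by letting $\lambda_f^2(z)$ and $\Lambda_f^2(z)$ be the smallest and the largest eigenvalues of the Hermitian matrix $A^*A$. For constants $K\ge1$, $K'\ge0$, a holomorphic mapping $f:B^n\to\mathbb{C}^n$ is $(K,K')$-quasiregular if $\Lambda_f(z)\le K\lambda_f(z)+K'$ for every $z\in B^n$. A schlicht ball of $f$ is a ball in $\mathbb{C}^n$ that is the univalent (injective) image under $f$ of some subdomain (nonempty connected open subset) of $B^n$; $\beta_f$ denotes the least upper bound of the radii of all schlicht balls of $f$. *)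

theory Defs
  imports "HOL-Analysis.Analysis"
begin

text \<open>
  The space of complex \<open>n\<close>-vectors is \<open>complex ^ 'n\<close> with \<open>n = CARD('n)\<close>; its library norm is
  the Euclidean norm, so \<open>ball 0 1\<close> is the open unit ball.
\<close>

definition conj_transpose :: "complex ^ 'n ^ 'm \<Rightarrow> complex ^ 'm ^ 'n" where
  "conj_transpose A = (\<chi> i j. cnj (A $ j $ i))"

definition eigenvalue :: "complex ^ 'n ^ 'n \<Rightarrow> complex \<Rightarrow> bool" where
  "eigenvalue A \<mu> \<longleftrightarrow> (\<exists>v. v \<noteq> 0 \<and> A *v v = \<mu> *s v)"

text \<open>
  Holomorphy in several variables: on an open set, total differentiability with a
  complex-linear derivative at every point.
\<close>

definition holomorphic_map_on :: "(complex ^ 'n \<Rightarrow> complex ^ 'm) \<Rightarrow> (complex ^ 'n) set \<Rightarrow> bool" where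
  "holomorphic_map_on f S \<longleftrightarrow> open S \<and> (\<forall>z\<in>S. \<exists>A. (f has_derivative (\<lambda>h. A *v h)) (at z))"

text \<open>The \<open>(i, k)\<close> entry is the complex partial derivative of the \<open>i\<close>-th component in the
  \<open>k\<close>-th variable.\<close>

definition complex_jacobian :: "(complex ^ 'n \<Rightarrow> complex ^ 'm) \<Rightarrow> complex ^ 'n \<Rightarrow> complex ^ 'n ^ 'm" where
  "complex_jacobian f z =
     (\<chi> i k. deriv (\<lambda>w. f (\<chi> j. if j = k then w else z $ j) $ i) (z $ k))"

lemma complex_jacobian_eqI:
  fixes f :: "complex ^ 'n \<Rightarrow> complex ^ 'm"
  assumes "(f has_derivative (\<lambda>h. A *v h)) (at z)"
  shows "complex_jacobian f z = A"
proof -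
  have "deriv (\<lambda>w. f (\<chi> j. if j = k then w else z $ j) $ i) (z $ k) = A $ i $ k" for i k
  proof -
    define u where "u = (\<lambda>w. \<chi> j. if j = k then w else z $ j)"
    have ueq: "u = (\<lambda>w. z + axis k (w - z $ k))"
      by (auto simp: u_def fun_eq_iff vec_eq_iff axis_def)
    have lin: "bounded_linear (\<lambda>h::complex. axis k h :: complex ^ 'n)"
      by (intro linear_conv_bounded_linear[THEN iffD1] linearI)
         (auto simp: vec_eq_iff axis_def)
    have "((\<lambda>w. w - z $ k) has_derivative (\<lambda>h. h)) (at (z $ k))"
      by (auto intro!: derivative_eq_intros)
    from bounded_linear.has_derivative[OF lin this]
    have du: "(u has_derivative (\<lambda>h. axis k h)) (at (z $ k))"
      unfolding ueq by (auto intro!: derivative_eq_intros)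
    have uz: "u (z $ k) = z"
      by (auto simp: u_def vec_eq_iff)
    have "((\<lambda>w. f (u w)) has_derivative (\<lambda>h. A *v axis k h)) (at (z $ k))"
      using has_derivative_compose[OF du, of f "\<lambda>h. A *v h"] assms uz by simp
    from bounded_linear.has_derivative[OF bounded_linear_vec_nth this]
    have "((\<lambda>w. f (u w) $ i) has_derivative (\<lambda>h. (A *v axis k h) $ i)) (at (z $ k))" .
    moreover have "(\<lambda>h. (A *v axis k h) $ i) = (*) (A $ i $ k)"
      by (auto simp: fun_eq_iff matrix_vector_mult_def axis_def if_distrib cong: if_cong)
    ultimately have "((\<lambda>w. f (u w) $ i) has_field_derivative A $ i $ k) (at (z $ k))"
      by (simp add: has_field_derivative_def)
    then show ?thesis
      unfolding u_def by (rule DERIV_imp_deriv)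
  qed
  then show ?thesis
    by (simp add: complex_jacobian_def vec_eq_iff)
qed

text \<open>
  Every eigenvalue of the Hermitian matrix below is a nonnegative real, so taking the minimum
  and maximum over its real eigenvalues loses nothing.
\<close>

definition gram_eigenvalues :: "(complex ^ 'n \<Rightarrow> complex ^ 'n) \<Rightarrow> complex ^ 'n \<Rightarrow> real set" where
  "gram_eigenvalues f z =
     {\<mu>. eigenvalue (conj_transpose (complex_jacobian f z) ** complex_jacobian f z)
           (complex_of_real \<mu>)}"

definition lambda_min :: "(complex ^ 'n \<Rightarrow> complex ^ 'n) \<Rightarrow> complex ^ 'n \<Rightarrow> real" where
  "lambda_min f z = sqrt (Min (gram_eigenvalues f z))"

definition lambda_max :: "(complex ^ 'n \<Rightarrow> complex ^ 'n) \<Rightarrow> complex ^ 'n \<Rightarrow> real" where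
  "lambda_max f z = sqrt (Max (gram_eigenvalues f z))"

definition quasiregular :: "real \<Rightarrow> real \<Rightarrow> (complex ^ 'n \<Rightarrow> complex ^ 'n) \<Rightarrow> bool" where
  "quasiregular K K' f \<longleftrightarrow>
     holomorphic_map_on f (ball 0 1) \<and>
     (\<forall>z\<in>ball 0 1. lambda_max f z \<le> K * lambda_min f z + K')"

definition schlicht_ball :: "(complex ^ 'n \<Rightarrow> complex ^ 'n) \<Rightarrow> complex ^ 'n \<Rightarrow> real \<Rightarrow> bool" where
  "schlicht_ball f a r \<longleftrightarrow> r > 0 \<and>
     (\<exists>U. U \<subseteq> ball 0 1 \<and> U \<noteq> {} \<and> open U \<and> connected U \<and> inj_on f U \<and> f ` U = ball a r)"

text \<open>The supremum is taken in the extended reals, since the radii may be unbounded.\<close>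

definition schlicht_radius :: "(complex ^ 'n \<Rightarrow> complex ^ 'n) \<Rightarrow> ereal" where
  "schlicht_radius f = (SUP r\<in>{r. \<exists>a. schlicht_ball f a r}. ereal r)"

end

theory Submission
  imports Defs "HOL-Complex_Analysis.Conformal_Mappings"
begin

text \<open>
  The argument is Landau's: near a point where a weighted version of the smallest stretching
  factor is almost maximal, the derivative is bounded above in terms of its value at that point,
  and a Schwarz lemma then forces the map to be univalent on a ball of controlled size.

  For \<open>r < 1\<close> the function \<open>(r - norm z) * lambda_min f z\<close> is bounded on the ball of radius \<open>r\<close>
  (Cauchy estimate, lemma \<open>lambda_min_bounded\<close>). At a point \<open>z0\<close> where it nearly attains
  its supremum, \<open>l = lambda_min f z0\<close> is at least \<open>\<alpha>\<close>, and \<open>lambda_min f \<le> 2 * l\<close> on a ball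
  around \<open>z0\<close> of radius \<open>\<rho>\<close> slightly less than half of \<open>r - norm z0\<close> (lemma
  \<open>near_maximum_of_weighted\<close>). Quasiregularity bounds the operator norm of the Jacobian on that
  ball by \<open>L = 2 * K * l + K'\<close>.

  Fix a nonzero direction \<open>u\<close> and let \<open>w\<close> be the unit vector along \<open>f'(z0) u\<close>. The scalar function
  sending \<open>z\<close> to the Hermitian product of \<open>f'(z) u\<close> with \<open>w\<close> is bounded by \<open>L * norm u\<close>, and at
  \<open>z0\<close> it equals a real number \<open>\<ge> l * norm u\<close>. By the Schwarz lemma its real part at distance
  \<open>t * \<rho>\<close> from \<open>z0\<close> is at least \<open>(l - (L + l) * t) * norm u\<close> (lemma
  \<open>derivative_stays_expanding\<close>). This is positive for \<open>t < l / (L + l)\<close>, so integrating along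
  segments yields injectivity on the ball of radius \<open>\<rho> * l / (L + l)\<close>, and integrating along radii
  shows that the boundary sphere is mapped outside the ball of radius
  \<open>R = \<rho> * l\<^sup>2 / (2 * (L + l))\<close> about \<open>f z0\<close>; hence that ball is schlicht
  (lemma \<open>schlicht_ball_of_derivative_bounds\<close>). Since \<open>\<rho> * l\<close> is at least nearly \<open>r * \<alpha> / 2\<close>, and since
  \<open>l / (2 * K * l + K' + l)\<close> is nondecreasing in \<open>l \<ge> \<alpha>\<close>, letting \<open>r\<close> tend to \<open>1\<close> gives the claimed constant.
\<close>

section \<open>Singular values as extreme stretching factors\<close>

text \<open>
  For a small step \<open>t\<close> from \<open>v\<close> against \<open>S v\<close>, the quadratic form of \<open>S\<close> changes by
  \<open>- 2 * t * (norm (S v))\<^sup>2\<close> up to second order; it would become negative if \<open>S v\<close> were nonzero.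
\<close>

lemma psd_self_adjoint_kernel:
  fixes S :: "'a::real_inner \<Rightarrow> 'a"
  assumes lin: "linear S"
    and adj: "\<And>x y. x \<bullet> S y = S x \<bullet> y"
    and psd: "\<And>x. x \<bullet> S x \<ge> 0"
    and v: "v \<bullet> S v = 0"
  shows "S v = 0"
proof (rule ccontr)
  assume "S v \<noteq> 0"
  define a where "a = S v \<bullet> S v"
  define c where "c = S v \<bullet> S (S v)"
  have a: "a > 0" and c: "c \<ge> 0"
    using \<open>S v \<noteq> 0\<close> psd by (auto simp: a_def c_def)
  have expand: "(v - t *\<^sub>R S v) \<bullet> S (v - t *\<^sub>R S v) = t * (t * c - 2 * a)" for t
    using v adj[of v "S v"]
    by (simp add: linear_diff[OF lin] linear_scale[OF lin] inner_diff a_def c_def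
        algebra_simps inner_commute)
  \<comment> \<open>Any positive \<open>t\<close> with \<open>t * c < 2 * a\<close> would do; the \<open>+ 1\<close> covers \<open>c = 0\<close>.\<close>
  define t where "t = a / (c + 1)"
  have t: "t > 0" "t * c \<le> a"
    using a c by (auto simp: t_def field_simps)
  have "t * (t * c - 2 * a) \<ge> 0"
    using psd[of "v - t *\<^sub>R S v"] by (simp only: expand)
  moreover have "t * (t * c - 2 * a) < 0"
    using t a by (intro mult_pos_neg) auto
  ultimately show False by simp
qed

text \<open>
  The inner product \<open>\<bullet>\<close> on complex vectors is the real one, i.e. the real part of the Hermitian
  product, and the conjugate transpose is the adjoint for it too. The spectral facts below can
  therefore be derived in a real Euclidean space.
\<close>

lemma inner_conj_transpose:
  fixes A :: "complex ^ 'n ^ 'm"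
  shows "x \<bullet> (conj_transpose A *v y) = (A *v x) \<bullet> y"
proof -
  have "x \<bullet> (conj_transpose A *v y) = (\<Sum>i\<in>UNIV. \<Sum>j\<in>UNIV. Re (cnj (x $ i) * (cnj (A $ j $ i) * y $ j)))"
    by (simp add: inner_vec_def conj_transpose_def matrix_vector_mult_def inner_complex_def
        sum_distrib_left distrib_left sum.distrib sum_subtractf right_diff_distrib)
  also have "\<dots> = (\<Sum>j\<in>UNIV. \<Sum>i\<in>UNIV. Re (cnj (x $ i) * (cnj (A $ j $ i) * y $ j)))"
    by (rule sum.swap)
  also have "\<dots> = (A *v x) \<bullet> y"
    by (simp add: inner_vec_def matrix_vector_mult_def inner_complex_def
        sum_distrib_right flip: sum.distrib)
       (simp add: algebra_simps)
  finally show ?thesis .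
qed

lemma inner_gram:
  fixes A :: "complex ^ 'n ^ 'n"
  shows "x \<bullet> ((conj_transpose A ** A) *v y) = (A *v x) \<bullet> (A *v y)"
  by (simp add: inner_conj_transpose flip: matrix_vector_mul_assoc)

lemma of_real_smult: "complex_of_real c *s v = c *\<^sub>R v" for v :: "complex ^ 'n"
  by (simp add: vec_eq_iff complex_eq_iff)

text \<open>
  Eigenvectors for different real eigenvalues of a self-adjoint map are orthogonal, hence
  independent. Finiteness is what makes \<open>Min\<close> and \<open>Max\<close> of the eigenvalues meaningful.
\<close>

lemma finite_gram_eigenvalues: "finite (gram_eigenvalues f z)"
proof -
  define A where "A = complex_jacobian f z"
  define T where "T = conj_transpose A ** A"
  define E where "E = gram_eigenvalues f z"
  have "\<forall>\<mu>\<in>E. \<exists>v. v \<noteq> 0 \<and> T *v v = \<mu> *\<^sub>R v"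
    by (simp add: E_def gram_eigenvalues_def eigenvalue_def T_def A_def of_real_smult)
  then obtain v where v: "\<And>\<mu>. \<mu> \<in> E \<Longrightarrow> v \<mu> \<noteq> 0" "\<And>\<mu>. \<mu> \<in> E \<Longrightarrow> T *v v \<mu> = \<mu> *\<^sub>R v \<mu>"
    by metis
  have orth: "v \<mu> \<bullet> v \<nu> = 0" if "\<mu> \<in> E" "\<nu> \<in> E" "\<mu> \<noteq> \<nu>" for \<mu> \<nu>
  proof -
    have "v \<mu> \<bullet> (T *v v \<nu>) = v \<nu> \<bullet> (T *v v \<mu>)"
      by (simp add: T_def inner_gram inner_commute)
    then show ?thesis
      using that by (simp add: v inner_commute)
  qed
  have "inj_on v E"
    by (metis inj_onI inner_eq_zero_iff orth v(1))
  moreover have "pairwise orthogonal (v ` E)"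
    using orth by (auto simp: pairwise_def orthogonal_def)
  then have "finite (v ` E)"
    using v(1) by (intro independent_imp_finite pairwise_orthogonal_independent) auto
  ultimately show ?thesis
    by (simp add: finite_image_iff E_def)
qed

lemma gram_eigenvalueI:
  assumes "v \<noteq> 0"
    and "(conj_transpose (complex_jacobian f z) ** complex_jacobian f z) *v v = \<mu> *\<^sub>R v"
  shows "\<mu> \<in> gram_eigenvalues f z"
  using assms by (auto simp: gram_eigenvalues_def eigenvalue_def of_real_smult)

text \<open>
  The minimum of the Rayleigh quotient, which exists by compactness of the sphere, is an eigenvalue:
  \<open>T - m\<close> is positive semidefinite and its form vanishes at the minimizer.
\<close>

lemma rayleigh_minimum:
  fixes T :: "'a::euclidean_space \<Rightarrow> 'a"
  assumes lin: "linear T"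
    and adj: "\<And>x y. x \<bullet> T y = T x \<bullet> y"
  obtains v m where "v \<noteq> 0" "T v = m *\<^sub>R v" "\<And>x. m * (norm x)\<^sup>2 \<le> x \<bullet> T x"
proof -
  have "continuous_on (sphere 0 1) (\<lambda>x. x \<bullet> T x)"
    using lin by (intro continuous_intros linear_continuous_on) (simp add: linear_conv_bounded_linear)
  moreover have "sphere (0::'a) 1 \<noteq> {}"
    using vector_choose_size[of 1] by auto
  ultimately obtain v where v: "norm v = 1"
    and min: "\<And>y. norm y = 1 \<Longrightarrow> v \<bullet> T v \<le> y \<bullet> T y"
    using continuous_attains_inf[of "sphere 0 1" "\<lambda>x. x \<bullet> T x"] by auto
  define m where "m = v \<bullet> T v"
  have low: "m * (norm x)\<^sup>2 \<le> x \<bullet> T x" for x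
  proof (cases "x = 0")
    case False
    define y where "y = x /\<^sub>R norm x"
    have x: "x = norm x *\<^sub>R y" and y: "norm y = 1"
      using False by (auto simp: y_def)
    have "x \<bullet> T x = (norm x)\<^sup>2 * (y \<bullet> T y)"
      by (subst (1 2) x) (simp add: linear_scale[OF lin] power2_eq_square)
    then show ?thesis
      using min[OF y] by (simp add: m_def mult.commute mult_right_mono)
  qed (simp add: linear_0[OF lin])
  define S where "S = (\<lambda>x. T x - m *\<^sub>R x)"
  have "S v = 0"
  proof (rule psd_self_adjoint_kernel[of S v])
    show "linear S"
      unfolding S_def using lin by (intro linear_compose_sub linear_scaleR)
    show "x \<bullet> S y = S x \<bullet> y" for x y
      by (simp add: S_def inner_diff adj)
    show "x \<bullet> S x \<ge> 0" for x
      using low[of x] by (simp add: S_def inner_diff power2_norm_eq_inner)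
    show "v \<bullet> S v = 0"
      using v by (simp add: S_def inner_diff m_def norm_eq_1)
  qed
  moreover have "v \<noteq> 0"
    using v by auto
  ultimately show thesis
    using that[of v m] low by (simp add: S_def)
qed

text \<open>
  Only the half of the min-max principle is stated that bounds the stretching of vectors: the least
  Rayleigh quotient is an eigenvalue, hence at least the smallest one.
\<close>

lemma lambda_min_le:
  "lambda_min f z * norm x \<le> norm (complex_jacobian f z *v x)"
proof -
  define A where "A = complex_jacobian f z"
  obtain v m where v: "v \<noteq> 0" "(conj_transpose A ** A) *v v = m *\<^sub>R v"
    and low: "\<And>x. m * (norm x)\<^sup>2 \<le> x \<bullet> ((conj_transpose A ** A) *v x)"
    using rayleigh_minimum[of "(*v) (conj_transpose A ** A)"]
    by (auto simp: inner_gram inner_commute)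
  have "m \<in> gram_eigenvalues f z"
    using v by (intro gram_eigenvalueI[of v]) (auto simp: A_def)
  then have "lambda_min f z \<le> sqrt m"
    unfolding lambda_min_def by (simp add: finite_gram_eigenvalues)
  then have "lambda_min f z * norm x \<le> sqrt (m * (norm x)\<^sup>2)"
    by (simp add: real_sqrt_mult mult_right_mono)
  also have "\<dots> \<le> norm (A *v x)"
    using real_sqrt_le_mono[OF low[of x]] by (simp add: inner_gram norm_eq_sqrt_inner)
  finally show ?thesis
    by (simp add: A_def)
qed

text \<open>
  The counterpart for the largest eigenvalue, from the Rayleigh minimum of the negated Gram matrix.
\<close>

lemma lambda_max_ge:
  "norm (complex_jacobian f z *v x) \<le> lambda_max f z * norm x"
proof -
  define A where "A = complex_jacobian f z"
  obtain v m where v: "v \<noteq> 0" "- ((conj_transpose A ** A) *v v) = m *\<^sub>R v"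
    and low: "\<And>x. m * (norm x)\<^sup>2 \<le> x \<bullet> (- ((conj_transpose A ** A) *v x))"
    using rayleigh_minimum[of "\<lambda>x. - ((conj_transpose A ** A) *v x)"]
    by (auto simp: inner_gram inner_commute linear_compose_neg)
  have "- m \<in> gram_eigenvalues f z"
    using v by (intro gram_eigenvalueI[of v]) (auto simp: A_def minus_equation_iff)
  then have *: "sqrt (- m) \<le> lambda_max f z"
    unfolding lambda_max_def by (simp add: finite_gram_eigenvalues)
  have "(norm (A *v x))\<^sup>2 \<le> - m * (norm x)\<^sup>2"
    using low[of x] by (simp add: inner_gram power2_norm_eq_inner)
  then have "norm (A *v x) \<le> sqrt (- m * (norm x)\<^sup>2)"
    by (rule real_le_rsqrt)
  also have "\<dots> = sqrt (- m) * norm x"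
    unfolding real_sqrt_mult by simp
  also have "\<dots> \<le> lambda_max f z * norm x"
    using * by (rule mult_right_mono) simp
  finally show ?thesis
    by (simp add: A_def)
qed

section \<open>The Hermitian product and holomorphic slices\<close>

definition cinner :: "complex ^ 'n \<Rightarrow> complex ^ 'n \<Rightarrow> complex" where
  "cinner x w = (\<Sum>i\<in>UNIV. x $ i * cnj (w $ i))"

lemma Re_cinner: "Re (cinner x w) = x \<bullet> w"
  by (simp add: cinner_def inner_vec_def inner_complex_def)

lemma norm_cinner_le: "norm (cinner x w) \<le> norm x * norm w"
proof -
  have "norm (cinner x w) \<le> (\<Sum>i\<in>UNIV. \<bar>norm (x $ i)\<bar> * \<bar>norm (w $ i)\<bar>)"
    unfolding cinner_def by (rule order_trans[OF norm_sum]) (simp add: norm_mult)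
  also have "\<dots> \<le> norm x * norm w"
    unfolding norm_vec_def by (rule L2_set_mult_ineq)
  finally show ?thesis .
qed

lemma cinner_same: "cinner w w = complex_of_real ((norm w)\<^sup>2)"
  by (simp add: cinner_def norm_vec_def L2_set_def sum_nonneg flip: complex_norm_square)

lemma cinner_diff: "cinner (x - y) w = cinner x w - cinner y w"
  by (simp add: cinner_def algebra_simps sum_subtractf)

lemma cinner_smult: "cinner (c *s x) w = c * cinner x w"
  by (simp add: cinner_def sum_distrib_left mult_ac)

lemma cinner_scaleR_right: "cinner x (c *\<^sub>R w) = complex_of_real c * cinner x w"
  by (simp add: of_real_smult[symmetric] cinner_def sum_distrib_left mult_ac)

lemma bounded_linear_cinner: "bounded_linear (\<lambda>x. cinner x w)"
  unfolding cinner_def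
  by (intro bounded_linear_sum bounded_linear_mult_const bounded_linear_vec_nth)

lemma norm_smult: "norm (c *s x) = norm c * norm x" for x :: "complex ^ 'n"
  by (simp add: norm_vec_def norm_mult L2_set_right_distrib)

lemma add_mem_ball: "a + x \<in> ball a r \<longleftrightarrow> norm x < r" for x :: "'a::real_normed_vector"
  by (simp add: dist_norm)

lemma holomorphic_on_ballI:
  assumes "\<And>\<zeta>. norm \<zeta> < s \<Longrightarrow> (h has_field_derivative d \<zeta>) (at \<zeta>)"
  shows "h holomorphic_on ball 0 s"
  unfolding holomorphic_on_open[OF open_ball]
  by (intro ballI exI, rule assms) simp

text \<open>
  Restriction to complex lines, followed by pairing with a fixed vector, turns a holomorphic map
  into a holomorphic function of one variable, to which the classical theorems apply.
\<close>

lemma slice_has_field_derivative: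
  fixes f :: "complex ^ 'n \<Rightarrow> complex ^ 'n"
  assumes "(f has_derivative (\<lambda>h. A *v h)) (at (p + \<zeta> *s e))"
  shows "((\<lambda>\<zeta>. cinner (f (p + \<zeta> *s e)) w) has_field_derivative cinner (A *v e) w) (at \<zeta>)"
proof -
  have "linear (\<lambda>\<zeta>. \<zeta> *s e)"
    by (intro linearI) (auto simp: vec_eq_iff algebra_simps)
  then have "((\<lambda>\<zeta>. p + \<zeta> *s e) has_derivative (\<lambda>h. h *s e)) (at \<zeta>)"
    by (auto intro!: derivative_eq_intros bounded_linear_imp_has_derivative
        simp: linear_conv_bounded_linear)
  from has_derivative_compose[OF this assms]
  have "((\<lambda>\<zeta>. f (p + \<zeta> *s e)) has_derivative (\<lambda>h. A *v (h *s e))) (at \<zeta>)"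
    by simp
  from bounded_linear.has_derivative[OF bounded_linear_cinner this]
  have "((\<lambda>\<zeta>. cinner (f (p + \<zeta> *s e)) w) has_derivative (\<lambda>h. cinner (A *v (h *s e)) w)) (at \<zeta>)" .
  moreover have "(\<lambda>h. cinner (A *v (h *s e)) w) = (*) (cinner (A *v e) w)"
    by (simp add: fun_eq_iff vector_scalar_commute cinner_smult mult.commute)
  ultimately show ?thesis
    by (simp add: has_field_derivative_def)
qed

section \<open>A Schwarz lemma for the derivative\<close>

text \<open>
  The function \<open>h - h 0\<close> vanishes at the origin and is bounded by \<open>B + norm (h 0)\<close>, so this is the
  Schwarz lemma after rescaling. The classical lemma wants a strict bound; it is applied with every
  \<open>C > B + norm (h 0)\<close> in place of the bound.
\<close>

lemma schwarz_deviation: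
  assumes hol: "h holomorphic_on ball 0 s"
    and bound: "\<And>\<zeta>. norm \<zeta> < s \<Longrightarrow> norm (h \<zeta>) \<le> B"
    and \<zeta>: "norm \<zeta> < s"
  shows "norm (h \<zeta> - h 0) \<le> (B + norm (h 0)) * (norm \<zeta> / s)"
proof -
  have s: "s > 0"
    using \<zeta> norm_ge_zero le_less_trans by blast
  have "norm (h \<zeta> - h 0) \<le> C * (norm \<zeta> / s)" if C: "C > B + norm (h 0)" for C
  proof -
    have "B \<ge> 0"
      using bound[of 0] s norm_ge_zero[of "h 0"] by (simp del: norm_ge_zero)
    then have C0: "C > 0"
      using C norm_ge_zero[of "h 0"] by linarith
    define g where "g = (\<lambda>\<xi>. (h (of_real s * \<xi>) - h 0) / of_real C)"
    have "norm (g (\<zeta> / of_real s)) \<le> norm (\<zeta> / of_real s)"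
    proof (rule Schwarz_Lemma(1))
      have "(h \<circ> (\<lambda>\<xi>. of_real s * \<xi>)) holomorphic_on ball 0 1"
        using s by (intro holomorphic_on_compose_gen[OF _ hol] holomorphic_intros)
          (auto simp: norm_mult)
      then show "g holomorphic_on ball 0 1"
        unfolding g_def o_def using C0 by (intro holomorphic_intros) auto
      show "g 0 = 0"
        by (simp add: g_def)
      show "norm (g \<xi>) < 1" if "norm \<xi> < 1" for \<xi>
      proof -
        have "norm (h (of_real s * \<xi>) - h 0) \<le> B + norm (h 0)"
          using bound[of "of_real s * \<xi>"] s that norm_triangle_ineq4[of "h (of_real s * \<xi>)" "h 0"]
          by (simp add: norm_mult)
        then show ?thesis
          using C C0 by (simp add: g_def norm_divide)
      qed
      show "norm (\<zeta> / of_real s) < 1"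
        using \<zeta> s by (simp add: norm_divide)
    qed
    then show ?thesis
      using s C0 by (simp add: g_def norm_divide field_simps)
  qed
  then have "norm (h \<zeta> - h 0) * s \<le> C * norm \<zeta>" if "C > B + norm (h 0)" for C
    using that s by (simp add: field_simps)
  moreover have "((\<lambda>C. C * norm \<zeta>) \<longlongrightarrow> (B + norm (h 0)) * norm \<zeta>) (at_right (B + norm (h 0)))"
    by (intro tendsto_intros)
  ultimately have "norm (h \<zeta> - h 0) * s \<le> (B + norm (h 0)) * norm \<zeta>"
    by (intro tendsto_lowerbound[where F = "at_right (B + norm (h 0))"])
       (auto simp: eventually_at_right_less intro: eventually_mono[OF eventually_at_right_less])
  then show ?thesis
    using s by (simp add: field_simps)
qed

text \<open>
  The estimate would follow from \<open>schwarz_deviation\<close> applied to the directional derivative itself,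
  once that is known to be holomorphic. To avoid showing this, the Schwarz lemma is applied to the
  difference quotients \<open>H \<eta>\<close> in the direction \<open>u\<close>, which are holomorphic along the line from \<open>z0\<close>
  to \<open>z\<close> and obey the same bound by the mean value inequality; then \<open>\<eta>\<close> tends to \<open>0\<close>.
\<close>

lemma derivative_deviation:
  fixes f :: "complex ^ 'n \<Rightarrow> complex ^ 'n"
  assumes der: "\<And>z. z \<in> ball z0 \<rho> \<Longrightarrow> (f has_derivative (\<lambda>h. f' z *v h)) (at z)"
    and bound: "\<And>z u. z \<in> ball z0 \<rho> \<Longrightarrow> norm (f' z *v u) \<le> L * norm u"
    and z: "z \<in> ball z0 \<rho>" and w: "norm w = 1"
  shows "norm (cinner (f' z *v u) w - cinner (f' z0 *v u) w)
    \<le> (L * norm u + norm (cinner (f' z0 *v u) w)) * (norm (z - z0) / \<rho>)"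
proof (cases "z = z0")
  case True
  then show ?thesis by simp
next
  case False
  define e where "e = z - z0"
  define d where "d = norm e"
  have d: "0 < d" "d < \<rho>"
    using False z by (auto simp: d_def e_def dist_norm norm_minus_commute)
  define H where "H \<eta> \<zeta> = (cinner (f ((z0 + complex_of_real \<eta> *s u) + \<zeta> *s e)) w
    - cinner (f (z0 + \<zeta> *s e)) w) / complex_of_real \<eta>" for \<eta> \<zeta>
  \<comment> \<open>Radius of a disc of parameters \<open>\<zeta>\<close> for which both arguments of \<open>f\<close> stay in the ball; \<open>\<zeta> = 1\<close> is the point \<open>z\<close>.\<close>
  define \<sigma> where "\<sigma> \<eta> = (\<rho> - \<eta> * norm u) / d" for \<eta>
  have est: "norm (H \<eta> 1 - H \<eta> 0) \<le> (L * norm u + norm (H \<eta> 0)) * (1 / \<sigma> \<eta>)"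
    if \<eta>: "\<eta> > 0" "\<eta> * norm u < \<rho> - d" for \<eta>
  proof -
    have in1: "z0 + \<zeta> *s e \<in> ball z0 \<rho>"
      and in2: "(z0 + complex_of_real \<eta> *s u) + \<zeta> *s e \<in> ball z0 \<rho>"
      if "norm \<zeta> < \<sigma> \<eta>" for \<zeta>
    proof -
      have le: "norm (\<zeta> *s e) < \<rho> - \<eta> * norm u"
        using that d by (simp add: \<sigma>_def norm_smult d_def field_simps)
      moreover have "0 \<le> \<eta> * norm u"
        using \<eta> by simp
      ultimately have "norm (\<zeta> *s e) < \<rho>"
        by linarith
      then show "z0 + \<zeta> *s e \<in> ball z0 \<rho>"
        by (simp add: dist_norm)
      have "norm (complex_of_real \<eta> *s u + \<zeta> *s e) < \<rho>"
        using norm_triangle_ineq[of "complex_of_real \<eta> *s u" "\<zeta> *s e"] le \<eta>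
        by (simp add: norm_smult)
      then show "(z0 + complex_of_real \<eta> *s u) + \<zeta> *s e \<in> ball z0 \<rho>"
        by (simp only: add_mem_ball add.assoc)
    qed
    have "norm (H \<eta> 1 - H \<eta> 0) \<le> (L * norm u + norm (H \<eta> 0)) * (norm (1::complex) / \<sigma> \<eta>)"
    proof (rule schwarz_deviation)
      show "H \<eta> holomorphic_on ball 0 (\<sigma> \<eta>)"
      proof -
        have "(\<lambda>\<zeta>. cinner (f ((z0 + complex_of_real \<eta> *s u) + \<zeta> *s e)) w) holomorphic_on ball 0 (\<sigma> \<eta>)"
          "(\<lambda>\<zeta>. cinner (f (z0 + \<zeta> *s e)) w) holomorphic_on ball 0 (\<sigma> \<eta>)"
          by (rule holomorphic_on_ballI[OF slice_has_field_derivative[OF der[OF in2]]],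
              assumption, rule holomorphic_on_ballI[OF slice_has_field_derivative[OF der[OF in1]]])
        then show ?thesis
          unfolding H_def using \<eta> by (intro holomorphic_intros) auto
      qed
      show "norm (H \<eta> \<zeta>) \<le> L * norm u" if \<zeta>: "norm \<zeta> < \<sigma> \<eta>" for \<zeta>
      proof -
        define p where "p = z0 + \<zeta> *s e"
        define q where "q = (z0 + complex_of_real \<eta> *s u) + \<zeta> *s e"
        have "norm (f q - f p) \<le> L * norm (q - p)"
        proof (rule differentiable_bound[OF convex_ball])
          show "(f has_derivative (\<lambda>h. f' x *v h)) (at x within ball z0 \<rho>)"
            if "x \<in> ball z0 \<rho>" for x
            using der[OF that] by (rule has_derivative_at_withinI)
          show "onorm (\<lambda>h. f' x *v h) \<le> L" if "x \<in> ball z0 \<rho>" for x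
            using bound[OF that] by (rule onorm_le)
          show "q \<in> ball z0 \<rho>" "p \<in> ball z0 \<rho>"
            using in1[OF \<zeta>] in2[OF \<zeta>] by (auto simp: p_def q_def)
        qed
        also have "norm (q - p) = \<eta> * norm u"
          using \<eta> by (simp add: p_def q_def norm_smult)
        finally have "norm (cinner (f q - f p) w) \<le> L * (\<eta> * norm u)"
          using norm_cinner_le[of "f q - f p" w] w by simp
        then show ?thesis
          using \<eta> by (simp add: H_def p_def q_def cinner_diff norm_divide field_simps)
      qed
      show "norm (1::complex) < \<sigma> \<eta>"
        using d \<eta> by (simp add: \<sigma>_def field_simps)
    qed
    then show ?thesis by simp
  qed
  have lim: "((\<lambda>\<eta>. (cinner (f (p + complex_of_real \<eta> *s u)) w - cinner (f p) w) / complex_of_real \<eta>)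
      \<longlongrightarrow> cinner (f' p *v u) w) (at_right 0)" if "p \<in> ball z0 \<rho>" for p
  proof -
    have "((\<lambda>\<zeta>. cinner (f (p + \<zeta> *s u)) w) has_field_derivative cinner (f' p *v u) w) (at 0)"
      using that by (intro slice_has_field_derivative) (simp add: der)
    then have "((\<lambda>h. (cinner (f (p + h *s u)) w - cinner (f p) w) / h)
        \<longlongrightarrow> cinner (f' p *v u) w) (at 0)"
      by (simp add: DERIV_def)
    moreover have "filterlim complex_of_real (at 0) (at_right 0)"
      by (intro filterlim_atI tendsto_eq_intros)
        (auto simp: eventually_at_right_less intro: eventually_mono[OF eventually_at_right_less])
    ultimately show ?thesis
      by (rule filterlim_compose)
  qed
  have z0: "z0 \<in> ball z0 \<rho>"
    using d by simp
  have H1: "((\<lambda>\<eta>. H \<eta> 1) \<longlongrightarrow> cinner (f' z *v u) w) (at_right 0)"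
    using lim[OF z] by (simp add: H_def e_def algebra_simps)
  have H0: "((\<lambda>\<eta>. H \<eta> 0) \<longlongrightarrow> cinner (f' z0 *v u) w) (at_right 0)"
    using lim[OF z0] by (simp add: H_def)
  have "((\<lambda>\<eta>. 1 / \<sigma> \<eta>) \<longlongrightarrow> 1 / ((\<rho> - 0 * norm u) / d)) (at_right 0)"
    unfolding \<sigma>_def using d by (intro tendsto_intros) auto
  then have S: "((\<lambda>\<eta>. 1 / \<sigma> \<eta>) \<longlongrightarrow> d / \<rho>) (at_right 0)"
    by simp
  have "((\<lambda>\<eta>. \<eta> * norm u) \<longlongrightarrow> 0 * norm u) (at_right (0::real))"
    by (intro tendsto_intros)
  then have "\<forall>\<^sub>F \<eta> in at_right 0. \<eta> * norm u < \<rho> - d"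
    using d by (intro order_tendstoD(2)[where y = "0 * norm u"]) auto
  then have "\<forall>\<^sub>F \<eta> in at_right 0.
      norm (H \<eta> 1 - H \<eta> 0) \<le> (L * norm u + norm (H \<eta> 0)) * (1 / \<sigma> \<eta>)"
    using eventually_at_right_less[of "0::real"] by eventually_elim (rule est)
  moreover have "((\<lambda>\<eta>. (L * norm u + norm (H \<eta> 0)) * (1 / \<sigma> \<eta>))
      \<longlongrightarrow> (L * norm u + norm (cinner (f' z0 *v u) w)) * (d / \<rho>)) (at_right 0)"
    by (intro tendsto_mult tendsto_add tendsto_const tendsto_norm H0 S)
  ultimately have "norm (cinner (f' z *v u) w - cinner (f' z0 *v u) w)
      \<le> (L * norm u + norm (cinner (f' z0 *v u) w)) * (d / \<rho>)"
    by (intro tendsto_le[OF _ _ tendsto_norm[OF tendsto_diff[OF H1 H0]]]) auto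
  then show ?thesis
    by (simp add: d_def e_def)
qed

text \<open>
  With \<open>c = norm (f' z0 *v u)\<close>, the Schwarz estimate gives the lower bound
  \<open>c - (L * norm u + c) * t\<close>. For \<open>t \<le> 1\<close> this increases with \<open>c\<close>, so \<open>c\<close> may be replaced by the
  smaller \<open>l * norm u\<close>; this is why \<open>l\<close>, and not the operator norm at \<open>z0\<close>, appears next to \<open>L\<close>.
  The vector \<open>w\<close> is the same for all \<open>z\<close>, so the bound can be integrated.
\<close>

lemma derivative_stays_expanding:
  fixes f :: "complex ^ 'n \<Rightarrow> complex ^ 'n"
  assumes der: "\<And>z. z \<in> ball z0 \<rho> \<Longrightarrow> (f has_derivative (\<lambda>h. f' z *v h)) (at z)"
    and bound: "\<And>z u. z \<in> ball z0 \<rho> \<Longrightarrow> norm (f' z *v u) \<le> L * norm u"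
    and low: "\<And>u. l * norm u \<le> norm (f' z0 *v u)"
    and "l > 0" and "u \<noteq> 0"
  obtains w where "norm w = 1"
    "\<And>z. z \<in> ball z0 \<rho> \<Longrightarrow> (l - (L + l) * (norm (z - z0) / \<rho>)) * norm u \<le> (f' z *v u) \<bullet> w"
proof -
  define a where "a = f' z0 *v u"
  define c where "c = norm a"
  define w where "w = a /\<^sub>R c"
  have c: "c \<ge> l * norm u" "c > 0"
    using low[of u] \<open>l > 0\<close> \<open>u \<noteq> 0\<close> mult_pos_pos[of l "norm u"] by (auto simp: c_def a_def simp del: mult_pos_pos)
  have w: "norm w = 1"
    using c by (simp add: w_def c_def)
  have aw: "cinner a w = complex_of_real c"
    using c by (simp add: w_def cinner_scaleR_right cinner_same c_def power2_eq_square)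
  have "(l - (L + l) * (norm (z - z0) / \<rho>)) * norm u \<le> (f' z *v u) \<bullet> w" if z: "z \<in> ball z0 \<rho>" for z
  proof -
    define t where "t = norm (z - z0) / \<rho>"
    have "norm (z - z0) < \<rho>"
      using z by (simp add: dist_norm norm_minus_commute)
    then have t: "t \<le> 1"
      using le_less_trans[OF norm_ge_zero \<open>norm (z - z0) < \<rho>\<close>] by (simp add: t_def)
    have "norm (cinner (f' z *v u) w - of_real c) \<le> (L * norm u + c) * t"
      using derivative_deviation[OF der bound z w, of u] c by (simp add: t_def aw flip: a_def)
    then have "c - Re (cinner (f' z *v u) w) \<le> (L * norm u + c) * t"
      using complex_Re_le_cmod[of "of_real c - cinner (f' z *v u) w"] by (simp add: norm_minus_commute)
    then have "c * (1 - t) - L * norm u * t \<le> (f' z *v u) \<bullet> w"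
      by (simp add: Re_cinner algebra_simps)
    moreover have "l * norm u * (1 - t) \<le> c * (1 - t)"
      using c(1) t by (intro mult_right_mono) auto
    ultimately show ?thesis
      by (simp add: t_def[symmetric] algebra_simps)
  qed
  with w show thesis
    by (rule that)
qed

section \<open>A schlicht ball from bounds on the derivative\<close>

lemma ray_has_real_derivative:
  fixes f :: "complex ^ 'n \<Rightarrow> complex ^ 'n"
  assumes "(f has_derivative (\<lambda>h. A *v h)) (at (p + s *\<^sub>R u))"
  shows "((\<lambda>s. f (p + s *\<^sub>R u) \<bullet> w) has_real_derivative (A *v u) \<bullet> w) (at s)"
proof -
  have "((\<lambda>s. p + s *\<^sub>R u) has_derivative (\<lambda>h. h *\<^sub>R u)) (at s)"
    by (auto intro!: derivative_eq_intros)
  from has_derivative_compose[OF this assms]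
  have "((\<lambda>s. f (p + s *\<^sub>R u)) has_derivative (\<lambda>h. A *v (h *\<^sub>R u))) (at s)"
    by simp
  from has_derivative_inner_left[OF this]
  have "((\<lambda>s. f (p + s *\<^sub>R u) \<bullet> w) has_derivative (\<lambda>h. (A *v (h *\<^sub>R u)) \<bullet> w)) (at s)" .
  moreover have "(\<lambda>h. (A *v (h *\<^sub>R u)) \<bullet> w) = (*) ((A *v u) \<bullet> w)"
    by (simp add: fun_eq_iff linear_scale)
  ultimately show ?thesis
    by (simp add: has_field_derivative_def)
qed

text \<open>
  The target ball is connected and is disjoint from the image of the sphere, so it is covered by two
  disjoint open sets: the image of the open ball (invariance of domain) and the complement of the
  image of the closed ball. Containing \<open>f z0\<close>, it lies in the former. The inverse of \<open>f\<close> is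
  continuous there and carries it to the connected domain \<open>U\<close>.
\<close>

lemma schlicht_ball_of_boundary_distance:
  fixes f :: "'a::euclidean_space \<Rightarrow> 'a"
  assumes cont: "continuous_on (cball z0 r) f" and inj: "inj_on f (ball z0 r)"
    and "r > 0" "R > 0"
    and far: "\<And>z. norm (z - z0) = r \<Longrightarrow> R \<le> norm (f z - f z0)"
  obtains U where "U \<subseteq> ball z0 r" "U \<noteq> {}" "open U" "connected U" "inj_on f U"
    "f ` U = ball (f z0) R"
proof -
  define U where "U = ball z0 r \<inter> f -` ball (f z0) R"
  have contb: "continuous_on (ball z0 r) f"
    using cont ball_subset_cball continuous_on_subset by blast
  have opn: "open (f ` ball z0 r)"
    using contb inj by (intro invariance_of_domain) auto
  have clo: "closed (f ` cball z0 r)"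
    using cont by (intro compact_imp_closed compact_continuous_image) auto
  have bdry: "f z \<notin> ball (f z0) R" if "z \<in> cball z0 r - ball z0 r" for z
    using far[of z] that by (auto simp: dist_norm norm_minus_commute)
  have "f ` ball z0 r \<inter> ball (f z0) R = {} \<or> - (f ` cball z0 r) \<inter> ball (f z0) R = {}"
  proof (rule connectedD[OF connected_ball])
    show "open (- (f ` cball z0 r))"
      using clo by auto
    show "ball (f z0) R \<subseteq> f ` ball z0 r \<union> - (f ` cball z0 r)"
      using bdry by blast
  qed (use opn ball_subset_cball in auto)
  moreover have "f z0 \<in> f ` ball z0 r \<inter> ball (f z0) R"
    using \<open>r > 0\<close> \<open>R > 0\<close> by auto
  ultimately have "ball (f z0) R \<subseteq> f ` cball z0 r"
    by blast
  then have img: "f ` U = ball (f z0) R"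
    using bdry unfolding U_def by blast
  have U: "U \<subseteq> ball z0 r" "open U"
    using contb by (auto simp: U_def intro: continuous_open_preimage)
  have injU: "inj_on f U"
    using inj U(1) inj_on_subset by blast
  have contU: "continuous_on U f"
    using contb U(1) continuous_on_subset by blast
  obtain g where "homeomorphism U (f ` U) f g"
    using invariance_of_domain_homeomorphism[OF \<open>open U\<close> contU _ injU] by auto
  then have "connected U"
    by (metis homeomorphic_connectedness homeomorphic_def connected_ball img)
  moreover have "U \<noteq> {}"
    using \<open>R > 0\<close> img by (metis centre_in_ball empty_iff image_empty)
  ultimately show thesis
    using that[OF U(1) _ U(2)] injU img by blast
qed

text \<open>
  The radius \<open>r\<close> is the distance at which the expansion factor \<open>l - (L + l) * r / \<rho>\<close> drops to
  zero; it is positive on the open ball, which makes \<open>f\<close> injective there. The image of the bounding sphere has distance from \<open>f z0\<close> at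
  least the integral of that factor over \<open>[0, r]\<close>, the area \<open>l * r / 2\<close> of a triangle.
\<close>

lemma schlicht_ball_of_derivative_bounds:
  fixes f :: "complex ^ 'n \<Rightarrow> complex ^ 'n"
  assumes der: "\<And>z. z \<in> ball z0 \<rho> \<Longrightarrow> (f has_derivative (\<lambda>h. f' z *v h)) (at z)"
    and bound: "\<And>z u. z \<in> ball z0 \<rho> \<Longrightarrow> norm (f' z *v u) \<le> L * norm u"
    and low: "\<And>u. l * norm u \<le> norm (f' z0 *v u)"
    and l: "l > 0" and \<rho>: "\<rho> > 0"
  obtains U where "U \<subseteq> ball z0 \<rho>" "U \<noteq> {}" "open U" "connected U" "inj_on f U"
    "f ` U = ball (f z0) (\<rho> * l\<^sup>2 / (2 * (L + l)))"
proof -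
  obtain e :: "complex ^ 'n" where "norm e = 1"
    using vector_choose_size[of 1] by auto
  \<comment> \<open>Both bounds at \<open>z0\<close> give \<open>l \<le> L\<close>.\<close>
  then have L: "L > 0"
    using low[of e] bound[of z0 e] l \<rho> by simp
  define r where "r = \<rho> * l / (L + l)"
  have r: "0 < r" "r < \<rho>"
    using l \<rho> L by (auto simp: r_def field_simps)
  have inj: "inj_on f (ball z0 r)"
  proof (rule inj_onI, rule ccontr)
    fix x y assume x: "x \<in> ball z0 r" and y: "y \<in> ball z0 r" and eq: "f x = f y" and "x \<noteq> y"
    define u where "u = y - x"
    have "u \<noteq> 0" using \<open>x \<noteq> y\<close> by (simp add: u_def)
    from derivative_stays_expanding[OF der bound low l this] obtain w where
      w: "\<And>z. z \<in> ball z0 \<rho> \<Longrightarrow> (l - (L + l) * (norm (z - z0) / \<rho>)) * norm u \<le> (f' z *v u) \<bullet> w"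
      by metis
    \<comment> \<open>The component of \<open>f\<close> along \<open>w\<close> is strictly increasing on the segment from \<open>x\<close> to \<open>y\<close>.\<close>
    have "f (x + 0 *\<^sub>R u) \<bullet> w < f (x + 1 *\<^sub>R u) \<bullet> w"
    proof (rule DERIV_pos_imp_increasing[where f = "\<lambda>s. f (x + s *\<^sub>R u) \<bullet> w"])
      fix s :: real assume s: "0 \<le> s" "s \<le> 1"
      define p where "p = x + s *\<^sub>R u"
      have "p = (1 - s) *\<^sub>R x + s *\<^sub>R y"
        by (simp add: p_def u_def algebra_simps)
      then have p: "p \<in> ball z0 r"
        using convexD[OF convex_ball x y, of "1 - s" s] s by simp
      then have p\<rho>: "p \<in> ball z0 \<rho>"
        using r by auto
      have "norm (p - z0) < r"
        using p by (simp add: dist_norm norm_minus_commute)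
      then have "(L + l) * (norm (p - z0) / \<rho>) < l"
        using l L \<rho> by (simp add: r_def field_simps)
      then have "0 < (l - (L + l) * (norm (p - z0) / \<rho>)) * norm u"
        using \<open>u \<noteq> 0\<close> by simp
      then have "(f' p *v u) \<bullet> w > 0"
        using w[OF p\<rho>] by linarith
      moreover have "((\<lambda>s. f (x + s *\<^sub>R u) \<bullet> w) has_real_derivative (f' p *v u) \<bullet> w) (at s)"
        using der[OF p\<rho>] by (intro ray_has_real_derivative) (simp add: p_def)
      ultimately show "\<exists>D. ((\<lambda>s. f (x + s *\<^sub>R u) \<bullet> w) has_real_derivative D) (at s) \<and> D > 0"
        by blast
    qed simp
    then show False
      using eq by (simp add: u_def)
  qed
  have far: "\<rho> * l\<^sup>2 / (2 * (L + l)) \<le> norm (f y - f z0)" if y: "norm (y - z0) = r" for y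
  proof -
    define u where "u = y - z0"
    have u: "norm u = r" "u \<noteq> 0"
      using y r by (auto simp: u_def)
    from derivative_stays_expanding[OF der bound low l u(2)] obtain w where w1: "norm w = 1" and
      w: "\<And>z. z \<in> ball z0 \<rho> \<Longrightarrow> (l - (L + l) * (norm (z - z0) / \<rho>)) * norm u \<le> (f' z *v u) \<bullet> w"
      by metis
    \<comment> \<open>Monotonicity of \<open>\<psi>\<close> replaces integration of the lower bound along the radius through \<open>y\<close>.\<close>
    define \<psi> where "\<psi> s = f (z0 + s *\<^sub>R u) \<bullet> w - (l * r * s - (L + l) * r\<^sup>2 / (2 * \<rho>) * s\<^sup>2)" for s
    have "\<psi> 0 \<le> \<psi> 1"
    proof (rule DERIV_nonneg_imp_nondecreasing[where f = \<psi>])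
      fix s :: real assume s: "0 \<le> s" "s \<le> 1"
      define p where "p = z0 + s *\<^sub>R u"
      have np: "norm (p - z0) = s * r"
        using s u by (simp add: p_def)
      have "s * r \<le> r"
        using s r by (simp add: mult_left_le_one_le)
      then have p: "p \<in> ball z0 \<rho>"
        using np r by (simp only: mem_ball dist_norm norm_minus_commute[of z0])
      define D where "D = (f' p *v u) \<bullet> w - (l * r - (L + l) * r\<^sup>2 / (2 * \<rho>) * (2 * s))"
      have "((\<lambda>s. f (z0 + s *\<^sub>R u) \<bullet> w) has_real_derivative (f' p *v u) \<bullet> w) (at s)"
        using der[OF p] by (intro ray_has_real_derivative) (simp add: p_def)
      then have "(\<psi> has_real_derivative D) (at s)"
        unfolding \<psi>_def D_def using \<rho> by (auto intro!: derivative_eq_intros)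
      moreover have "D \<ge> 0"
        using w[OF p] \<rho> by (simp add: D_def np u field_simps power2_eq_square)
      ultimately show "\<exists>D. (\<psi> has_real_derivative D) (at s) \<and> D \<ge> 0"
        by blast
    qed simp
    then have "l * r - (L + l) * r\<^sup>2 / (2 * \<rho>) \<le> (f y - f z0) \<bullet> w"
      by (simp add: \<psi>_def u_def inner_diff)
    also have "\<dots> \<le> norm (f y - f z0)"
      using norm_cauchy_schwarz[of "f y - f z0" w] w1 by simp
    also have "l * r - (L + l) * r\<^sup>2 / (2 * \<rho>) = \<rho> * l\<^sup>2 / (2 * (L + l))"
    proof -
      have "(L + l) * r = \<rho> * l"
        using L l by (simp add: r_def)
      then have "(L + l) * r\<^sup>2 / (2 * \<rho>) = l * r / 2"
        using \<rho> by (simp add: power2_eq_square field_simps)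
      then have "l * r - (L + l) * r\<^sup>2 / (2 * \<rho>) = l * r / 2"
        by linarith
      also have "\<dots> = \<rho> * l\<^sup>2 / (2 * (L + l))"
        by (simp add: r_def power2_eq_square algebra_simps)
      finally show ?thesis .
    qed
    finally show ?thesis .
  qed
  have "continuous_on (cball z0 r) f"
    using r by (intro continuous_at_imp_continuous_on ballI has_derivative_continuous[OF der]) auto
  moreover have "\<rho> * l\<^sup>2 / (2 * (L + l)) > 0"
    using \<rho> l L by simp
  ultimately obtain U where "U \<subseteq> ball z0 r" "U \<noteq> {}" "open U" "connected U" "inj_on f U"
    "f ` U = ball (f z0) (\<rho> * l\<^sup>2 / (2 * (L + l)))"
    using schlicht_ball_of_boundary_distance[OF _ inj r(1) _ far] by metis
  then show thesis
    using that[of U] r(2) by (meson subset_ball less_imp_le order_trans)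
qed

section \<open>Choosing the centre\<close>

text \<open>
  The smallest stretching factor is at most the stretching in one fixed direction \<open>e\<close>, and that is
  controlled by the Cauchy inequality on discs in the direction \<open>e\<close>, because \<open>f\<close> is bounded on a
  slightly larger closed ball.
\<close>

lemma lambda_min_bounded:
  fixes f :: "complex ^ 'n \<Rightarrow> complex ^ 'n"
  assumes hol: "holomorphic_map_on f (ball 0 1)" and "r < 1"
  obtains N where "\<And>z. norm z < r \<Longrightarrow> lambda_min f z \<le> N"
proof -
  have der: "(f has_derivative (\<lambda>h. complex_jacobian f z *v h)) (at z)" if "z \<in> ball 0 1" for z
    using hol that complex_jacobian_eqI unfolding holomorphic_map_on_def by metis
  define \<delta> where "\<delta> = (1 - r) / 2"
  have \<delta>: "\<delta> > 0" "r + \<delta> < 1"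
    using \<open>r < 1\<close> by (auto simp: \<delta>_def field_simps)
  have "continuous_on (cball 0 (r + \<delta>)) f"
    using \<delta> by (intro continuous_at_imp_continuous_on ballI has_derivative_continuous[OF der]) auto
  then have "bounded (f ` cball 0 (r + \<delta>))"
    by (intro compact_imp_bounded compact_continuous_image) auto
  then obtain B where B: "\<And>x. norm x \<le> r + \<delta> \<Longrightarrow> norm (f x) \<le> B"
    unfolding bounded_iff by (metis imageI mem_cball_0)
  obtain e :: "complex ^ 'n" where e: "norm e = 1"
    using vector_choose_size[of 1] by auto
  have "lambda_min f z \<le> B / \<delta>" if z: "norm z < r" for z
  proof -
    define a where "a = complex_jacobian f z *v e"
    have "B \<ge> 0"
      using B[of z] z \<delta> norm_ge_zero[of "f z"] by linarith
    have "norm a \<le> B / \<delta>"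
    proof (cases "a = 0")
      case True
      then show ?thesis using \<open>B \<ge> 0\<close> \<delta> by simp
    next
      case False
      define w where "w = a /\<^sub>R norm a"
      have w: "norm w = 1"
        using False by (simp add: w_def)
      have aw: "cinner a w = of_real (norm a)"
        using False by (simp add: w_def cinner_scaleR_right cinner_same power2_eq_square)
      define h where "h \<zeta> = cinner (f (z + \<zeta> *s e)) w" for \<zeta>
      have near: "norm (z + \<zeta> *s e) < r + \<delta>" if "norm \<zeta> \<le> \<delta>" for \<zeta>
        using norm_triangle_ineq[of z "\<zeta> *s e"] z that e by (simp add: norm_smult)
      have dh: "(h has_field_derivative cinner (complex_jacobian f (z + \<zeta> *s e) *v e) w) (at \<zeta>)"
        if "norm \<zeta> \<le> \<delta>" for \<zeta>
        unfolding h_def using near[OF that] \<delta> by (intro slice_has_field_derivative der) auto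
      have "norm ((deriv ^^ 1) h 0) \<le> fact 1 * B / \<delta> ^ 1"
      proof (rule Cauchy_inequality)
        show "h holomorphic_on ball 0 \<delta>"
          by (rule holomorphic_on_ballI[OF dh]) simp
        show "continuous_on (cball 0 \<delta>) h"
          using dh by (intro continuous_at_imp_continuous_on) (auto intro!: DERIV_isCont)
        show "norm (h \<zeta>) \<le> B" if "norm (0 - \<zeta>) = \<delta>" for \<zeta>
          using norm_cinner_le[of "f (z + \<zeta> *s e)" w] w near[of \<zeta>] B[of "z + \<zeta> *s e"] that
          by (simp add: h_def)
      qed (use \<delta> in auto)
      moreover have "deriv h 0 = cinner a w"
        using DERIV_imp_deriv[OF dh[of 0]] \<delta> by (simp add: a_def)
      ultimately show ?thesis
        by (simp add: aw)
    qed
    then show ?thesis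
      using lambda_min_le[of f z e] e by (simp add: a_def)
  qed
  then show thesis by (rule that)
qed

text \<open>
  With continuity of \<open>\<phi>\<close> one would take a maximum point of \<open>(r - norm z) * \<phi> z\<close> and
  \<open>\<theta> = 1 / 2\<close>. For \<open>\<theta> < 1 / 2\<close> it is enough to come within the factor \<open>1 / (2 * (1 - \<theta>)) < 1\<close>
  of the supremum, since on the ball around \<open>z0\<close> the weight \<open>r - norm z\<close> is still at least
  \<open>(1 - \<theta>) * (r - norm z0)\<close>.
\<close>

lemma near_maximum_of_weighted:
  fixes \<phi> :: "'a::real_normed_vector \<Rightarrow> real"
  assumes bdd: "\<And>z. norm z < r \<Longrightarrow> \<phi> z \<le> N"
    and \<alpha>: "0 < \<alpha>" "\<alpha> \<le> \<phi> 0" and \<theta>: "0 < \<theta>" "\<theta> < 1 / 2" and r: "0 < r"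
  obtains z0 where "norm z0 < r" "r * \<alpha> \<le> (r - norm z0) * \<phi> z0"
    "\<And>z. z \<in> ball z0 (\<theta> * (r - norm z0)) \<Longrightarrow> norm z < r \<and> \<phi> z \<le> 2 * \<phi> z0"
proof -
  define g where "g z = (r - norm z) * \<phi> z" for z
  define M where "M = Sup (g ` ball 0 r)"
  have N: "N > 0"
    using bdd[of 0] r \<alpha> by simp
  have "g z \<le> r * N" if "norm z < r" for z
  proof -
    have "g z \<le> (r - norm z) * N"
      unfolding g_def using bdd[OF that] that by (intro mult_left_mono) auto
    also have "\<dots> \<le> r * N"
      using N by (intro mult_right_mono) auto
    finally show ?thesis .
  qed
  then have bd: "bdd_above (g ` ball 0 r)"
    by (auto intro!: bdd_aboveI2)
  have up: "g z \<le> M" if "norm z < r" for z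
    unfolding M_def using bd that by (intro cSup_upper) auto
  have g0: "r * \<alpha> \<le> g 0"
    using r \<alpha> by (simp add: g_def)
  then have M: "M > 0"
    using up[of 0] r mult_pos_pos[OF r \<alpha>(1)] by (simp del: mult_pos_pos)
  then have "M / (2 * (1 - \<theta>)) < M"
    using \<theta> by (simp add: field_simps)
  then obtain y where y: "norm y < r" "M / (2 * (1 - \<theta>)) < g y"
    using less_cSup_iff[OF _ bd, of "M / (2 * (1 - \<theta>))"] r by (auto simp: M_def)
  \<comment> \<open>If the near-maximal value is below \<open>r * \<alpha>\<close>, then the origin is an even better choice.\<close>
  obtain z0 where z0: "norm z0 < r" "M / (2 * (1 - \<theta>)) < g z0" "r * \<alpha> \<le> g z0"
  proof (cases "g y \<ge> r * \<alpha>")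
    case True
    then show ?thesis using that y by blast
  next
    case False
    then show ?thesis using that[of 0] y g0 r by simp
  qed
  have near: "norm z < r \<and> \<phi> z \<le> 2 * \<phi> z0" if z: "z \<in> ball z0 (\<theta> * (r - norm z0))" for z
  proof -
    define b where "b = r - norm z0"
    have b: "b > 0" using z0 by (simp add: b_def)
    have "norm (z - z0) < \<theta> * b"
      using z by (simp add: b_def dist_norm norm_minus_commute)
    then have far: "(1 - \<theta>) * b < r - norm z"
      using norm_triangle_ineq2[of z z0] by (simp add: b_def algebra_simps)
    have pos: "(1 - \<theta>) * b > 0"
      using \<theta> b by simp
    have zr: "norm z < r"
      using far pos by linarith
    have "M < 2 * (1 - \<theta>) * (b * \<phi> z0)"
      using z0(2) \<theta> by (simp add: g_def b_def field_simps)
    then have *: "(r - norm z) * \<phi> z < ((1 - \<theta>) * b) * (2 * \<phi> z0)"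
      using up[OF zr] by (simp add: g_def algebra_simps)
    have "r * \<alpha> > 0"
      using r \<alpha> by simp
    then have "b * \<phi> z0 > 0"
      using z0(3) by (simp add: g_def b_def)
    then have "\<phi> z0 > 0"
      using b by (simp add: zero_less_mult_iff)
    then have "((1 - \<theta>) * b) * (2 * \<phi> z0) \<le> (r - norm z) * (2 * \<phi> z0)"
      using far by (intro mult_right_mono) auto
    with * have "(r - norm z) * \<phi> z < (r - norm z) * (2 * \<phi> z0)"
      by linarith
    then have "\<phi> z < 2 * \<phi> z0"
      using zr by simp
    with zr show ?thesis by simp
  qed
  show thesis
    using that[OF z0(1)] z0(3) near by (simp add: g_def)
qed

text \<open>
  The radius \<open>r\<close> of the auxiliary ball and the parameter \<open>\<theta> = r / 2\<close> each cost one factor \<open>r\<close>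
  compared with the limiting radius, which is recovered as \<open>r\<close> tends to \<open>1\<close>.
\<close>

lemma schlicht_ball_quasiregular:
  fixes f :: "complex ^ 'n \<Rightarrow> complex ^ 'n"
  assumes K: "K \<ge> 1" "K' \<ge> 0"
    and qr: "quasiregular K K' f"
    and \<alpha>: "\<alpha> > 0" "lambda_min f 0 \<ge> \<alpha>"
    and r: "0 < r" "r < 1"
  shows "\<exists>a R. schlicht_ball f a R \<and> r\<^sup>2 * (\<alpha>\<^sup>2 / (4 * (2 * K * \<alpha> + K' + \<alpha>))) \<le> R"
proof -
  have hol: "holomorphic_map_on f (ball 0 1)"
    and dist: "\<And>z. z \<in> ball 0 1 \<Longrightarrow> lambda_max f z \<le> K * lambda_min f z + K'"
    using qr by (auto simp: quasiregular_def)
  have der: "(f has_derivative (\<lambda>h. complex_jacobian f z *v h)) (at z)" if "z \<in> ball 0 1" for z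
    using hol that complex_jacobian_eqI unfolding holomorphic_map_on_def by metis
  obtain N where N: "\<And>z. norm z < r \<Longrightarrow> lambda_min f z \<le> N"
    using lambda_min_bounded[OF hol r(2)] by blast
  obtain z0 where z0: "norm z0 < r" "r * \<alpha> \<le> (r - norm z0) * lambda_min f z0"
    and near: "\<And>z. z \<in> ball z0 (r / 2 * (r - norm z0)) \<Longrightarrow>
      norm z < r \<and> lambda_min f z \<le> 2 * lambda_min f z0"
  proof (rule near_maximum_of_weighted[of r "lambda_min f" N \<alpha> "r / 2"])
    show "r / 2 < 1 / 2" "0 < r / 2"
      using r by auto
  qed (use N \<alpha> r in blast)+
  \<comment> \<open>This is \<open>\<theta> * (r - norm z0)\<close> for \<open>\<theta> = r / 2\<close>.\<close>
  define \<rho> where "\<rho> = r / 2 * (r - norm z0)"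
  define l where "l = lambda_min f z0"
  define L where "L = 2 * K * l + K'"
  have \<rho>: "\<rho> > 0"
    using r z0 by (simp add: \<rho>_def)
  have pos: "r * \<alpha> > 0"
    using r \<alpha> by simp
  then have "(r - norm z0) * l > 0"
    using z0(2) by (simp only: l_def)
  then have "l > 0"
    using z0(1) by (simp add: zero_less_mult_iff)
  have "(r - norm z0) * l \<le> r * l"
    using \<open>l > 0\<close> by (intro mult_right_mono) auto
  then have "r * \<alpha> \<le> r * l"
    using z0(2) by (simp add: l_def)
  then have l: "\<alpha> \<le> l"
    using r by simp
  have sub: "ball z0 \<rho> \<subseteq> ball 0 1"
    using near r by (fastforce simp: \<rho>_def)
  have "norm (complex_jacobian f z *v u) \<le> L * norm u" if z: "z \<in> ball z0 \<rho>" for z u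
  proof -
    have "lambda_max f z \<le> K * lambda_min f z + K'"
      using dist sub z by blast
    also have "\<dots> \<le> K * (2 * l) + K'"
      using near[of z] z K by (simp add: \<rho>_def l_def)
    finally have "lambda_max f z * norm u \<le> L * norm u"
      by (intro mult_right_mono) (auto simp: L_def)
    then show ?thesis
      using lambda_max_ge[of f z u] by linarith
  qed
  with schlicht_ball_of_derivative_bounds[of z0 \<rho> f "complex_jacobian f" L l]
  obtain U where U: "U \<subseteq> ball z0 \<rho>" "U \<noteq> {}" "open U" "connected U" "inj_on f U"
    "f ` U = ball (f z0) (\<rho> * l\<^sup>2 / (2 * (L + l)))"
    using der sub lambda_min_le[of f z0] \<open>l > 0\<close> \<rho> by (auto simp: l_def subset_iff)
  have pL: "2 * (L + l) > 0" "2 * K * \<alpha> + K' + \<alpha> > 0"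
    using K \<open>l > 0\<close> \<alpha>(1) by (auto simp: L_def intro!: add_nonneg_pos add_pos_nonneg)
  have "r\<^sup>2 * (\<alpha>\<^sup>2 / (4 * (2 * K * \<alpha> + K' + \<alpha>))) = (r\<^sup>2 * \<alpha> / 4) * (\<alpha> / (2 * K * \<alpha> + K' + \<alpha>))"
    by (simp add: power2_eq_square)
  also have "\<dots> \<le> (r\<^sup>2 * \<alpha> / 4) * (l / (L + l))"
  proof (rule mult_left_mono)
    \<comment> \<open>After clearing denominators, monotonicity in \<open>l\<close> is exactly this inequality.\<close>
    have "\<alpha> * K' \<le> l * K'"
      using l K by (intro mult_right_mono) auto
    then show "\<alpha> / (2 * K * \<alpha> + K' + \<alpha>) \<le> l / (L + l)"
      using pL by (simp add: divide_simps) (simp add: L_def algebra_simps)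
  qed (use \<alpha> in auto)
  also have "\<dots> = (r / 2 * (r * \<alpha>)) * (l / (2 * (L + l)))"
    by (simp add: power2_eq_square)
  also have "\<dots> \<le> (r / 2 * ((r - norm z0) * l)) * (l / (2 * (L + l)))"
    using z0(2) r \<open>l > 0\<close> pL(1) by (intro mult_right_mono mult_left_mono) (auto simp: l_def)
  also have "\<dots> = \<rho> * l\<^sup>2 / (2 * (L + l))"
    by (simp add: \<rho>_def power2_eq_square)
  finally have "r\<^sup>2 * (\<alpha>\<^sup>2 / (4 * (2 * K * \<alpha> + K' + \<alpha>))) \<le> \<rho> * l\<^sup>2 / (2 * (L + l))" .
  moreover have "schlicht_ball f (f z0) (\<rho> * l\<^sup>2 / (2 * (L + l)))"
    unfolding schlicht_ball_def
  proof (intro conjI exI[of _ U])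
    show "0 < \<rho> * l\<^sup>2 / (2 * (L + l))"
      using \<rho> \<open>l > 0\<close> pL(1) by simp
    show "U \<subseteq> ball 0 1"
      using U(1) sub by (rule order_trans)
  qed (fact U)+
  ultimately show ?thesis by blast
qed

theorem theorem2:
  fixes f :: "complex ^ 'n \<Rightarrow> complex ^ 'n" and K K' \<alpha> :: real
  assumes "K \<ge> 1" and "K' \<ge> 0"
    and "quasiregular K K' f"
    and "\<alpha> > 0" and "lambda_min f 0 \<ge> \<alpha>"
  shows "schlicht_radius f \<ge> ereal (\<alpha>\<^sup>2 / (4 * (2 * K * \<alpha> + K' + \<alpha>)))"
proof (rule ereal_le_real)
  fix b assume b: "schlicht_radius f \<le> ereal b"
  have "s * (\<alpha>\<^sup>2 / (4 * (2 * K * \<alpha> + K' + \<alpha>))) \<le> b" if s: "0 < s" "s < 1" for s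
  proof -
    obtain a R where aR: "schlicht_ball f a R"
      "(sqrt s)\<^sup>2 * (\<alpha>\<^sup>2 / (4 * (2 * K * \<alpha> + K' + \<alpha>))) \<le> R"
      using schlicht_ball_quasiregular[OF assms, of "sqrt s"] s by auto
    have "ereal R \<le> schlicht_radius f"
      unfolding schlicht_radius_def using aR(1) by (intro SUP_upper) auto
    then have "R \<le> b"
      using b order_trans by fastforce
    then show ?thesis
      using aR(2) s by simp
  qed
  then show "ereal (\<alpha>\<^sup>2 / (4 * (2 * K * \<alpha> + K' + \<alpha>))) \<le> ereal b"
    by (simp add: field_le_mult_one_interval)
qed

end
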